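(* Let $\Xi_2$ be the set of all $\lambda\in\mathbb{C}$ such that $\lambda$ is an eigenvalue of some $2\times2$ monotone matrix. Then $\Xi_2=[0,1]$ (the real closed interval, viewed as a subset of $\mathbb{C}$).
   Context: A stochastic matrix is a (real) entrywise non-negative square matrix each of whose row sums equals $1$. An $n\times n$ monotone matrix is an $n\times n$ stochastic matrix $M=(m_{ij})$ such that $\sum_{j=r}^n m_{lj}\ge\sum_{j=r}^n m_{kj}$ for all $l>k$ in $\{1,\dots,n\}$ and all $r\in\{1,\dots,n\}$. *)

theory Defs
  imports Complex_Main "Jordan_Normal_Form.Char_Poly"
begin

definition stochastic_matrix :: "nat \<Rightarrow> real mat \<Rightarrow> bool" where
  "stochastic_matrix n M \<longleftrightarrow>
     M \<in> carrier_mat n n \<and>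
     (\<forall>i<n. \<forall>j<n. 0 \<le> M $$ (i, j)) \<and>
     (\<forall>i<n. (\<Sum>j = 0..<n. M $$ (i, j)) = 1)"

(* Indices run over 0, ..., n - 1 instead of 1, ..., n, so {r..<n} is the
   tail r, ..., n of the mathematical notation shifted by one. *)
definition monotone_matrix :: "nat \<Rightarrow> real mat \<Rightarrow> bool" where
  "monotone_matrix n M \<longleftrightarrow>
     stochastic_matrix n M \<and>
     (\<forall>k<n. \<forall>l<n. \<forall>r<n. k < l \<longrightarrow>
        (\<Sum>j = r..<n. M $$ (k, j)) \<le> (\<Sum>j = r..<n. M $$ (l, j)))"

(* Eigenvalues are taken over the complex numbers, so the real matrix is
   first mapped entrywise into them. *)
definition Xi :: "nat \<Rightarrow> complex set" where
  "Xi n = {z. \<exists>M. monotone_matrix n M \<and> eigenvalue (map_mat complex_of_real M) z}"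

end

theory Submission
  imports Defs
begin

text \<open>A stochastic matrix always has the eigenvalue 1, with the all-ones vector as
  eigenvector. For size 2 the other eigenvalue is therefore the trace minus 1, which the row sums
  turn into the difference of the two entries in the last column
  (\<open>eigenvalue_stochastic_2\<close>). Monotonicity says exactly that this difference is
  nonnegative (\<open>monotone_matrix_2_iff\<close>), and it is at most 1 because the entries lie
  between 0 and 1. Conversely, a triangular matrix realises every value in the interval.\<close>

lemma det_2:
  fixes A :: "'a :: comm_ring_1 mat"
  assumes "A \<in> carrier_mat 2 2"
  shows "det A = A $$ (0, 0) * A $$ (1, 1) - A $$ (0, 1) * A $$ (1, 0)"
proof -
  \<comment> \<open>The minors in the expansion along the first row are 1 by 1, so each equals its
    only entry.\<close>
  have "det (mat_delete A 0 j) = mat_delete A 0 j $$ (0, 0)" for j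
    using assms by (intro det_single) (auto simp: mat_delete_def)
  then show ?thesis
    using assms laplace_expansion_row[OF assms, of 0]
    by (simp add: cofactor_def mat_delete_def numeral_2_eq_2)
qed

text \<open>The row sums determine the first column from the second, and the characteristic
  polynomial then splits into linear factors over the reals. In particular no eigenvalue is
  non-real.\<close>

lemma eigenvalue_stochastic_2:
  assumes "stochastic_matrix 2 M"
  shows "eigenvalue (map_mat complex_of_real M) z \<longleftrightarrow>
    z = 1 \<or> z = complex_of_real (M $$ (1, 1) - M $$ (0, 1))"
proof -
  let ?A = "map_mat complex_of_real M"
  have M: "M \<in> carrier_mat 2 2"
    and rows: "\<And>i. i < 2 \<Longrightarrow> (\<Sum>j = 0..<2. M $$ (i, j)) = 1"
    using assms unfolding stochastic_matrix_def by auto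
  have row0: "M $$ (0, 0) = 1 - M $$ (0, 1)" and row1: "M $$ (1, 0) = 1 - M $$ (1, 1)"
    using rows[of 0] rows[of 1] by (simp_all add: numeral_2_eq_2)
  have A: "?A \<in> carrier_mat 2 2"
    using M by simp
  have "det (char_matrix ?A z) =
      (complex_of_real (M $$ (0, 0)) - z) * (complex_of_real (M $$ (1, 1)) - z) -
      complex_of_real (M $$ (0, 1)) * complex_of_real (M $$ (1, 0))"
    unfolding det_2[OF char_matrix_closed[OF A]]
    using M by (simp add: char_matrix_def)
  \<comment> \<open>With a and d the upper and lower entries of the last column, this is (1 - a -
    z)(d - z) - a(1 - d) = (1 - z)(d - a - z).\<close>
  also have "\<dots> = (1 - z) * (complex_of_real (M $$ (1, 1) - M $$ (0, 1)) - z)"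
    unfolding row0 row1 of_real_diff of_real_1 by (simp add: algebra_simps)
  finally have "det (char_matrix ?A z) =
      (1 - z) * (complex_of_real (M $$ (1, 1) - M $$ (0, 1)) - z)" .
  then show ?thesis
    unfolding eigenvalue_det[OF A] by auto
qed

text \<open>There is only one pair of rows to compare. The tail at \<open>r = 0\<close> is the full
  row sum, 1 in both rows, so the only real constraint is the tail at \<open>r = 1\<close>, a single
  entry in each row.\<close>

lemma monotone_matrix_2_iff:
  "monotone_matrix 2 M \<longleftrightarrow> stochastic_matrix 2 M \<and> M $$ (0, 1) \<le> M $$ (1, 1)"
proof
  assume "monotone_matrix 2 M"
  then have "stochastic_matrix 2 M" "(\<Sum>j = 1..<2. M $$ (0, j)) \<le> (\<Sum>j = 1..<2. M $$ (1, j))"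
    unfolding monotone_matrix_def by simp_all
  then show "stochastic_matrix 2 M \<and> M $$ (0, 1) \<le> M $$ (1, 1)"
    by (simp add: numeral_2_eq_2)
next
  assume M: "stochastic_matrix 2 M \<and> M $$ (0, 1) \<le> M $$ (1, 1)"
  have "(\<Sum>j = r..<2. M $$ (0, j)) \<le> (\<Sum>j = r..<2. M $$ (1, j))" if r: "r < 2" for r
  proof -
    consider "r = 0" | "r = 1"
      using r by linarith
    then show ?thesis
      using M by cases (simp_all add: stochastic_matrix_def numeral_2_eq_2)
  qed
  then show "monotone_matrix 2 M"
    using M by (simp add: monotone_matrix_def less_2_cases_iff)
qed

theorem theorem3p2:
  shows "Xi 2 = complex_of_real ` {0..1}"
proof (intro equalityI subsetI)
  fix z assume "z \<in> Xi 2"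
  then obtain M where M: "stochastic_matrix 2 M" "M $$ (0, 1) \<le> M $$ (1, 1)"
    and ev: "eigenvalue (map_mat complex_of_real M) z"
    unfolding Xi_def monotone_matrix_2_iff by auto
  have "0 \<le> M $$ (0, 1)" "0 \<le> M $$ (1, 0)" "M $$ (1, 0) + M $$ (1, 1) = 1"
    using M(1) by (auto simp: stochastic_matrix_def numeral_2_eq_2)
  \<comment> \<open>The lower bound is monotonicity; the upper bound holds because
    \<open>M $$ (1, 1)\<close> is at most 1 and \<open>M $$ (0, 1)\<close> is at least 0.\<close>
  with M(2) have "M $$ (1, 1) - M $$ (0, 1) \<in> {0..1}"
    by simp
  moreover have "(1::real) \<in> {0..1}"
    by simp
  moreover have "z = complex_of_real 1 \<or> z = complex_of_real (M $$ (1, 1) - M $$ (0, 1))"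
    using ev unfolding eigenvalue_stochastic_2[OF M(1)] of_real_1 .
  ultimately show "z \<in> complex_of_real ` {0..1}"
    by (elim disjE) (rule image_eqI, assumption, assumption)+
next
  fix z assume "z \<in> complex_of_real ` {0..1}"
  then obtain t where t: "0 \<le> t" "t \<le> 1" "z = complex_of_real t"
    by auto
  \<comment> \<open>The rows are (1, 0) and (1 - t, t). The zero in the upper right corner makes the
    matrix lower triangular with \<open>t\<close> on the diagonal, and reduces monotonicity to
    \<open>0 \<le> t\<close>.\<close>
  define M :: "real mat" where
    "M = mat 2 2 (\<lambda>(i, j). if i = 0 then (if j = 0 then 1 else 0) else (if j = 0 then 1 - t else t))"
  have entries: "M $$ (0, 0) = 1" "M $$ (0, 1) = 0" "M $$ (1, 0) = 1 - t" "M $$ (1, 1) = t"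
    by (simp_all add: M_def)
  have M: "stochastic_matrix 2 M"
    unfolding stochastic_matrix_def
  proof (intro conjI)
    show "M \<in> carrier_mat 2 2"
      by (simp add: M_def)
    show "\<forall>i<2. \<forall>j<2. 0 \<le> M $$ (i, j)"
      using t by (simp add: M_def)
    show "\<forall>i<2. (\<Sum>j = 0..<2. M $$ (i, j)) = 1"
      by (simp add: M_def sum.atLeast0_lessThan_Suc numeral_2_eq_2)
  qed
  have "monotone_matrix 2 M"
    unfolding monotone_matrix_2_iff entries using M t(1) by blast
  moreover have "eigenvalue (map_mat complex_of_real M) z"
    unfolding eigenvalue_stochastic_2[OF M] entries t(3) by simp
  ultimately show "z \<in> Xi 2"
    unfolding Xi_def by auto
qed

end
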